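(* Fix constants $(M,D,R)$ and finite subsets $A,B\subseteq\mathbb{N}\cup\{0\}$, both containing $0$, which are rooted increasing rough isometric with constants $(M,D,R)$. Let $L$ be the set of all rooted increasing rough isometries $T:A\to B$ with constants $(M,D,R)$. For $T_1,T_2\in L$ define $T_1\vee T_2, T_1\wedge T_2:A\to B$ by $(T_1\vee T_2)(x):=\max(T_1(x),T_2(x))$ and $(T_1\wedge T_2)(x):=\min(T_1(x),T_2(x))$. Then for any $T_1,T_2\in L$, we have $T_1\vee T_2\in L$ and $T_1\wedge T_2\in L$.
   Context: For $A,B\subseteq\mathbb{N}\cup\{0\}$ both containing $0$ and constants $M>0$, $D,R\ge0$, a rooted increasing rough isometry from $A$ to $B$ with constants $(M,D,R)$ is a mapping $T:A\to B$ with $T(0)=0$ which is weakly increasing ($T(x)\ge T(y)$ whenever $x\ge y$) and such that: (i) for all $x_1,x_2\in A$, $\frac1M |x_1-x_2|-D\le |T(x_1)-T(x_2)|\le M|x_1-x_2|+D$; (ii) for every $b\in B$ there is $x\in A$ with $|b-T(x)|\le R$. $A$ and $B$ are rooted increasing rough isometric with constants $(M,D,R)$ if such a $T$ exists. *)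

theory Defs
  imports Complex_Main "HOL-Library.FuncSet"
begin

definition rooted_increasing_rough_isometry ::
  "nat set \<Rightarrow> nat set \<Rightarrow> real \<Rightarrow> real \<Rightarrow> real \<Rightarrow> (nat \<Rightarrow> nat) \<Rightarrow> bool" where
  "rooted_increasing_rough_isometry A B M D R T \<longleftrightarrow>
     T \<in> A \<rightarrow> B \<and> T 0 = 0 \<and> mono_on A T \<and>
     (\<forall>x1\<in>A. \<forall>x2\<in>A.
        1 / M * \<bar>real x1 - real x2\<bar> - D \<le> \<bar>real (T x1) - real (T x2)\<bar> \<and>
        \<bar>real (T x1) - real (T x2)\<bar> \<le> M * \<bar>real x1 - real x2\<bar> + D) \<and>
     (\<forall>b\<in>B. \<exists>x\<in>A. \<bar>real b - real (T x)\<bar> \<le> R)"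

definition rooted_increasing_rough_isometric ::
  "nat set \<Rightarrow> nat set \<Rightarrow> real \<Rightarrow> real \<Rightarrow> real \<Rightarrow> bool" where
  "rooted_increasing_rough_isometric A B M D R \<longleftrightarrow>
     (\<exists>T. rooted_increasing_rough_isometry A B M D R T)"

text \<open>
  A mapping from \<open>A\<close> to \<open>B\<close> is an element of the extensional function space \<open>A \<rightarrow>\<^sub>E B\<close>
  (undefined outside \<open>A\<close>), so that mappings are equal iff they agree on \<open>A\<close>. The pointwise
  maximum and minimum are restricted to \<open>A\<close> accordingly.
\<close>

definition rough_isometries ::
  "nat set \<Rightarrow> nat set \<Rightarrow> real \<Rightarrow> real \<Rightarrow> real \<Rightarrow> (nat \<Rightarrow> nat) set" where
  "rough_isometries A B M D R =
     {T \<in> A \<rightarrow>\<^sub>E B. rooted_increasing_rough_isometry A B M D R T}"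

definition join_on :: "nat set \<Rightarrow> (nat \<Rightarrow> nat) \<Rightarrow> (nat \<Rightarrow> nat) \<Rightarrow> nat \<Rightarrow> nat" where
  "join_on A T1 T2 = (\<lambda>x\<in>A. max (T1 x) (T2 x))"

definition meet_on :: "nat set \<Rightarrow> (nat \<Rightarrow> nat) \<Rightarrow> (nat \<Rightarrow> nat) \<Rightarrow> nat \<Rightarrow> nat" where
  "meet_on A T1 T2 = (\<lambda>x\<in>A. min (T1 x) (T2 x))"

end

theory Submission
  imports Defs
begin

text \<open>If both maxima come from the same pair, \<open>a\<close>, \<open>c\<close> or
  \<open>b\<close>, \<open>d\<close>, the bounds are hypotheses. Otherwise the four numbers form a
  chain, for example b \<le> a \<le> c \<le> d, and the gap between the maxima, here d - a, lies
  between c - a and d - b. The first assumption excludes crossings such as 0, 5 against 5, 0, whose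
  maxima coincide.\<close>

lemma abs_diff_max_bounds:
  fixes a b c d :: nat and l u :: real
  assumes "a \<le> c \<and> b \<le> d \<or> c \<le> a \<and> d \<le> b"
    and "l \<le> \<bar>real a - real c\<bar>" "\<bar>real a - real c\<bar> \<le> u"
    and "l \<le> \<bar>real b - real d\<bar>" "\<bar>real b - real d\<bar> \<le> u"
  shows "l \<le> \<bar>real (max a b) - real (max c d)\<bar> \<and> \<bar>real (max a b) - real (max c d)\<bar> \<le> u"
  using assms by (auto simp: max_def abs_if split: if_splits)

text \<open>The same nesting of gaps serves the minima: in the mixed case the chain is, for example,
  a \<le> b \<le> d \<le> c, and d - a lies between d - b and c - a.\<close>

lemma abs_diff_min_bounds:
  fixes a b c d :: nat and l u :: real
  assumes "a \<le> c \<and> b \<le> d \<or> c \<le> a \<and> d \<le> b"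
    and "l \<le> \<bar>real a - real c\<bar>" "\<bar>real a - real c\<bar> \<le> u"
    and "l \<le> \<bar>real b - real d\<bar>" "\<bar>real b - real d\<bar> \<le> u"
  shows "l \<le> \<bar>real (min a b) - real (min c d)\<bar> \<and> \<bar>real (min a b) - real (min c d)\<bar> \<le> u"
  using assms by (auto simp: min_def abs_if split: if_splits)

text \<open>The only nontrivial case is \<open>T x < S x\<close> and \<open>S y < T y\<close>; then monotonicity forces
  the maximum at the smaller of \<open>x\<close>, \<open>y\<close> into \<open>[b - R, b + R]\<close>. For the minimum it is
  the larger one.\<close>

lemma max_dense:
  fixes T S :: "nat \<Rightarrow> nat" and b R :: real
  assumes T: "mono_on A T" and S: "mono_on A S"
    and x: "x \<in> A" "\<bar>b - real (T x)\<bar> \<le> R" and y: "y \<in> A" "\<bar>b - real (S y)\<bar> \<le> R"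
  shows "\<exists>z\<in>A. \<bar>b - real (max (T z) (S z))\<bar> \<le> R"
proof (cases "x \<le> y")
  case True
  then have "T x \<le> T y" "S x \<le> S y"
    using mono_onD[OF T] mono_onD[OF S] x y by blast+
  then have "\<bar>b - real (max (T x) (S x))\<bar> \<le> R \<or> \<bar>b - real (max (T y) (S y))\<bar> \<le> R"
    using x y by (auto simp: max_def abs_if split: if_splits)
  then show ?thesis using x y by blast
next
  case False
  then have "T y \<le> T x" "S y \<le> S x"
    using mono_onD[OF T] mono_onD[OF S] x y by simp_all
  then have "\<bar>b - real (max (T x) (S x))\<bar> \<le> R \<or> \<bar>b - real (max (T y) (S y))\<bar> \<le> R"
    using x y by (auto simp: max_def abs_if split: if_splits)
  then show ?thesis using x y by blast
qed

lemma min_dense: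
  fixes T S :: "nat \<Rightarrow> nat" and b R :: real
  assumes T: "mono_on A T" and S: "mono_on A S"
    and x: "x \<in> A" "\<bar>b - real (T x)\<bar> \<le> R" and y: "y \<in> A" "\<bar>b - real (S y)\<bar> \<le> R"
  shows "\<exists>z\<in>A. \<bar>b - real (min (T z) (S z))\<bar> \<le> R"
proof (cases "x \<le> y")
  case True
  then have "T x \<le> T y" "S x \<le> S y"
    using mono_onD[OF T] mono_onD[OF S] x y by blast+
  \<comment> \<open>For minima the case to settle is \<open>S x < T x\<close> and
    \<open>T y < S y\<close>. Then T x \<le> T y < S y puts \<open>T y\<close> between two points
    within \<open>R\<close> of \<open>b\<close>.\<close>
  then have "\<bar>b - real (min (T x) (S x))\<bar> \<le> R \<or> \<bar>b - real (min (T y) (S y))\<bar> \<le> R"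
    using x y by (auto simp: min_def abs_if split: if_splits)
  then show ?thesis using x y by blast
next
  case False
  then have "T y \<le> T x" "S y \<le> S x"
    using mono_onD[OF T] mono_onD[OF S] x y by simp_all
  \<comment> \<open>In the same case, now S y \<le> S x < T x, so the minimum at \<open>x\<close> is
    within \<open>R\<close> of \<open>b\<close>.\<close>
  then have "\<bar>b - real (min (T x) (S x))\<bar> \<le> R \<or> \<bar>b - real (min (T y) (S y))\<bar> \<le> R"
    using x y by (auto simp: min_def abs_if split: if_splits)
  then show ?thesis using x y by blast
qed

theorem lemma3p5:
  fixes A B :: "nat set" and M D R :: real and T1 T2 :: "nat \<Rightarrow> nat"
  assumes "M > 0" and "D \<ge> 0" and "R \<ge> 0"
    and "finite A" and "finite B" and "0 \<in> A" and "0 \<in> B"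
    and "rooted_increasing_rough_isometric A B M D R"
    and "T1 \<in> rough_isometries A B M D R"
    and "T2 \<in> rough_isometries A B M D R"
  shows "join_on A T1 T2 \<in> rough_isometries A B M D R \<and>
         meet_on A T1 T2 \<in> rough_isometries A B M D R"
proof -
  have iso: "rooted_increasing_rough_isometry A B M D R T1"
    "rooted_increasing_rough_isometry A B M D R T2"
    using assms by (auto simp: rough_isometries_def)
  note iso' = iso[unfolded rooted_increasing_rough_isometry_def]
  have mono: "mono_on A T1" "mono_on A T2" using iso' by auto
  have range: "T1 x \<in> B" "T2 x \<in> B" if "x \<in> A" for x using iso' that by auto
  have zero: "T1 0 = 0" "T2 0 = 0" using iso' by auto
  \<comment> \<open>Points of \<open>A\<close> are comparable, so both maps move in the same
    direction between them; this rules out the crossing that would break the lower bound.\<close>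
  have ordered: "T1 x \<le> T1 y \<and> T2 x \<le> T2 y \<or> T1 y \<le> T1 x \<and> T2 y \<le> T2 x"
    if "x \<in> A" "y \<in> A" for x y
    using that mono nat_le_linear[of x y] by (meson mono_onD)
  have quasi: "1 / M * \<bar>real x - real y\<bar> - D \<le> \<bar>real (T x) - real (T y)\<bar>"
    "\<bar>real (T x) - real (T y)\<bar> \<le> M * \<bar>real x - real y\<bar> + D"
    if "T \<in> {T1, T2}" "x \<in> A" "y \<in> A" for T x y
    using iso' that by blast+
  have dense: "\<exists>x\<in>A. \<bar>real b - real (T1 x)\<bar> \<le> R" "\<exists>x\<in>A. \<bar>real b - real (T2 x)\<bar> \<le> R"
    if "b \<in> B" for b
    using iso' that by auto
  have "rooted_increasing_rough_isometry A B M D R (join_on A T1 T2)"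
    unfolding rooted_increasing_rough_isometry_def
  proof (intro conjI ballI)
    show "join_on A T1 T2 \<in> A \<rightarrow> B" using range by (auto simp: join_on_def max_def)
    \<comment> \<open>Membership of 0 in \<open>A\<close> matters: outside \<open>A\<close> the
      restricted map takes the value \<open>undefined\<close>.\<close>
    show "join_on A T1 T2 0 = 0" using zero \<open>0 \<in> A\<close> by (simp add: join_on_def)
    show "mono_on A (join_on A T1 T2)"
      using mono_onD[OF mono(1)] mono_onD[OF mono(2)]
      by (intro mono_onI) (simp only: join_on_def restrict_apply' max.mono)
  next
    fix x y assume xy: "x \<in> A" "y \<in> A"
    \<comment> \<open>The bounds depend only on \<open>x\<close> and \<open>y\<close>, not on the
      map, so \<open>T1\<close> and \<open>T2\<close> share the same \<open>l\<close> and
      \<open>u\<close>.\<close>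
    note b = abs_diff_max_bounds[OF ordered[OF xy] quasi[of T1, OF _ xy] quasi[of T2, OF _ xy]]
    show "1 / M * \<bar>real x - real y\<bar> - D \<le> \<bar>real (join_on A T1 T2 x) - real (join_on A T1 T2 y)\<bar>"
      "\<bar>real (join_on A T1 T2 x) - real (join_on A T1 T2 y)\<bar> \<le> M * \<bar>real x - real y\<bar> + D"
      using b xy by (simp_all add: join_on_def)
  next
    fix b assume "b \<in> B"
    \<comment> \<open>\<open>T1\<close> and \<open>T2\<close> may come close to \<open>b\<close> at
      different points; \<open>max_dense\<close> selects one of the two that works for the
      maximum.\<close>
    then have "\<exists>z\<in>A. \<bar>real b - real (max (T1 z) (T2 z))\<bar> \<le> R"
      using dense max_dense[OF mono] by blast
    then show "\<exists>x\<in>A. \<bar>real b - real (join_on A T1 T2 x)\<bar> \<le> R"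
      by (simp add: join_on_def)
  qed
  moreover have "rooted_increasing_rough_isometry A B M D R (meet_on A T1 T2)"
    unfolding rooted_increasing_rough_isometry_def
  proof (intro conjI ballI)
    show "meet_on A T1 T2 \<in> A \<rightarrow> B" using range by (auto simp: meet_on_def min_def)
    show "meet_on A T1 T2 0 = 0" using zero \<open>0 \<in> A\<close> by (simp add: meet_on_def)
    show "mono_on A (meet_on A T1 T2)"
      using mono_onD[OF mono(1)] mono_onD[OF mono(2)]
      by (intro mono_onI) (simp only: meet_on_def restrict_apply' min.mono)
  next
    fix x y assume xy: "x \<in> A" "y \<in> A"
    note b = abs_diff_min_bounds[OF ordered[OF xy] quasi[of T1, OF _ xy] quasi[of T2, OF _ xy]]
    show "1 / M * \<bar>real x - real y\<bar> - D \<le> \<bar>real (meet_on A T1 T2 x) - real (meet_on A T1 T2 y)\<bar>"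
      "\<bar>real (meet_on A T1 T2 x) - real (meet_on A T1 T2 y)\<bar> \<le> M * \<bar>real x - real y\<bar> + D"
      using b xy by (simp_all add: meet_on_def)
  next
    fix b assume "b \<in> B"
    then have "\<exists>z\<in>A. \<bar>real b - real (min (T1 z) (T2 z))\<bar> \<le> R"
      using dense min_dense[OF mono] by blast
    then show "\<exists>x\<in>A. \<bar>real b - real (meet_on A T1 T2 x)\<bar> \<le> R"
      by (simp add: meet_on_def)
  qed
  \<comment> \<open>Each value is one of the two given values, hence in \<open>B\<close>, and the
    restriction to \<open>A\<close> supplies extensionality.\<close>
  moreover have "join_on A T1 T2 \<in> A \<rightarrow>\<^sub>E B" "meet_on A T1 T2 \<in> A \<rightarrow>\<^sub>E B"
    using range by (auto simp: join_on_def meet_on_def max_def min_def)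
  ultimately show ?thesis by (simp add: rough_isometries_def)
qed

end
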